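(* Let $G_0^*$ be a $k$-uniform hypergraph with vertices $v_1,\dots,v_n$ ($n\ge1$), and let $G_1^*$ and $H_1^*$ be non-isomorphic $(k,r)$-regular hypergraphs on $m\ge2$ vertices whose adjacency matrices have the same spectrum, where $2\le k\le m+1$. Let $G^*$ (resp. $H^*$) be the generalized corona $G_0^*\odot_1^n G_i^*$ with $p=1$, $t=n$, $U_i=\{v_i\}$ and $G_i^*=G_1^*$ (resp. $G_i^*=H_1^*$) for all $i$. Then $G^*$ and $H^*$ are not regular (not every vertex lies in the same number of hyperedges), and $S(G^* )$ and $S(H^* )$ have the same spectrum.
   Context: All hypergraphs are finite and simple: a hypergraph $G^*=(V,E)$ consists of a finite vertex set $V$ and a set $E$ of subsets of $V$ (hyperedges), each of size at least $2$. It is $k$-uniform if every hyperedge has exactly $k$ elements, and $(k,r)$-regular if it is $k$-uniform and every vertex lies in exactly $r$ hyperedges. For a hypergraph with vertices $v_1,\dots,v_n$, the adjacency matrix $A(G^* )$ is the $n\times n$ matrix whose $(i,j)$ entry, for $i\ne j$, is the number of hyperedges containing both $v_i$ and $v_j$, and whose diagonal entries are $0$; the Seidel matrix is $S(G^* )=J_n-I_n-2A(G^* )$, where $J_n$ is the all-ones matrix and $I_n$ the identity. Generalized corona: let $G_0^*$ be a $k$-uniform hypergraph with vertex set $V_0$, $\{U_1,\dots,U_t\}$ a partition of $V_0$ with $|U_i|=p$, and $G_1^*,\dots,G_t^*$ $k$-uniform hypergraphs. The generalized corona $G_0^*\odot_p^t G_i^*$ is the $k$-uniform hypergraph obtained as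 follows: for each $i$ take $p$ copies $G_i^{*(1)},\dots,G_i^{*(p)}$ of $G_i^*$, all copies pairwise vertex-disjoint and disjoint from $V_0$. The vertex set is $V_0$ together with the vertices of all copies; the hyperedges are the hyperedges of $G_0^*$, the hyperedges of every copy, and, for every $i\in\{1,\dots,t\}$ and $j\in\{1,\dots,p\}$, every $k$-element subset of $U_i\cup V(G_i^{*(j)})$ that meets both $U_i$ and $V(G_i^{*(j)})$. *)

theory Defs
  imports "Jordan_Normal_Form.Char_Poly" "HOL-Computational_Algebra.Polynomial"
begin

definition hypergraph :: "'a set \<Rightarrow> 'a set set \<Rightarrow> bool" where
  "hypergraph V E \<longleftrightarrow> finite V \<and> (\<forall>e\<in>E. e \<subseteq> V \<and> card e \<ge> 2)"

definition uniform_hg :: "nat \<Rightarrow> 'a set \<Rightarrow> 'a set set \<Rightarrow> bool" where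
  "uniform_hg k V E \<longleftrightarrow> hypergraph V E \<and> (\<forall>e\<in>E. card e = k)"

definition hdegree :: "'a set set \<Rightarrow> 'a \<Rightarrow> nat" where
  "hdegree E v = card {e\<in>E. v \<in> e}"

definition regular_hg :: "nat \<Rightarrow> nat \<Rightarrow> 'a set \<Rightarrow> 'a set set \<Rightarrow> bool" where
  "regular_hg k r V E \<longleftrightarrow> uniform_hg k V E \<and> (\<forall>v\<in>V. hdegree E v = r)"

definition is_regular :: "'a set \<Rightarrow> 'a set set \<Rightarrow> bool" where
  "is_regular V E \<longleftrightarrow> (\<exists>r. \<forall>v\<in>V. hdegree E v = r)"

definition hg_isomorphic :: "'a set \<Rightarrow> 'a set set \<Rightarrow> 'b set \<Rightarrow> 'b set set \<Rightarrow> bool" where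
  "hg_isomorphic V E W F \<longleftrightarrow>
     (\<exists>f. bij_betw f V W \<and> (\<forall>e. e \<subseteq> V \<longrightarrow> (e \<in> E \<longleftrightarrow> f ` e \<in> F)))"

definition vertex_enum :: "'a set \<Rightarrow> nat \<Rightarrow> 'a" where
  "vertex_enum V = (SOME f. bij_betw f {..<card V} V)"

definition adj_matrix :: "'a set \<Rightarrow> 'a set set \<Rightarrow> real mat" where
  "adj_matrix V E = mat (card V) (card V)
     (\<lambda>(i,j). if i = j then 0
             else real (card {e\<in>E. vertex_enum V i \<in> e \<and> vertex_enum V j \<in> e}))"

definition seidel_matrix :: "'a set \<Rightarrow> 'a set set \<Rightarrow> real mat" where
  "seidel_matrix V E = (let n = card V in
     mat n n (\<lambda>_. 1) - 1\<^sub>m n - smult_mat 2 (adj_matrix V E))"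

definition spectrum_mset :: "real mat \<Rightarrow> complex multiset" where
  "spectrum_mset A = proots (char_poly (map_mat complex_of_real A))"

text \<open>Generalized corona with p = 1, t = |V0|, U_i = {v_i}, all G_i equal to (V1,E1).
  Vertex Inl v is the vertex v of G0; Inr (v,u) is vertex u of the copy attached to v.\<close>
definition corona_V :: "'a set \<Rightarrow> 'b set \<Rightarrow> ('a + 'a \<times> 'b) set" where
  "corona_V V0 V1 = Inl ` V0 \<union> (\<Union>v\<in>V0. (\<lambda>u. Inr (v,u)) ` V1)"

definition corona_E :: "nat \<Rightarrow> 'a set \<Rightarrow> 'a set set \<Rightarrow> 'b set \<Rightarrow> 'b set set
    \<Rightarrow> ('a + 'a \<times> 'b) set set" where
  "corona_E k V0 E0 V1 E1 =
     (image Inl) ` E0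
   \<union> {(\<lambda>u. Inr (v,u)) ` e | v e. v \<in> V0 \<and> e \<in> E1}
   \<union> {S. \<exists>v\<in>V0. S \<subseteq> {Inl v} \<union> (\<lambda>u. Inr (v,u)) ` V1 \<and> card S = k
          \<and> Inl v \<in> S \<and> S \<inter> (\<lambda>u. Inr (v,u)) ` V1 \<noteq> {}}"

end

theory Submission
  imports Defs
begin

text \<open>Let $Z = tI - A(G_1^*)$ and $Z' = tI - A(H_1^*)$ on a common index set, with $t$ not an
  eigenvalue. Both have constant column sums $t - r(k-1)$ and the same determinant, so
  $Q = Z^{-1}Z'$ has column sums $1$ and determinant $1$. For $x = -2t - 1 + 2d$, where $d$ is the
  number of new hyperedges through two given vertices of one copy, each diagonal copy block of
  $xI - S(G^*)$ is $-2Z$ plus a multiple of $J$, and every other block meeting a copy has constant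
  rows. Hence $xI - S(H^*) = (xI - S(G^*)) \cdot \mathrm{diag}(I, Q, \dots, Q)$ and the two
  characteristic polynomials agree at all but finitely many points.

  In the corona a root has degree at least ${m \choose k-1}$, a vertex of a copy
  has degree $r + {m-1 \choose k-2}$. Equality would force $r \ge {m-1 \choose k-1}$, which makes
  both $G_1^*$ and $H_1^*$ complete and thus isomorphic.\<close>

section \<open>Determinants indexed by finite sets\<close>

text \<open>Indexing by vertices instead of positions lets a vertex set be split into roots and
  copies directly. The enumeration is the one used by \<open>adj_matrix\<close>, so characteristic
  polynomials evaluate to such determinants; the value does not depend on the enumeration
  (\<open>set_det_enum\<close>).\<close>

definition set_det :: "'a set \<Rightarrow> ('a \<Rightarrow> 'a \<Rightarrow> 'c::comm_ring_1) \<Rightarrow> 'c" where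
  "set_det V g = det (mat (card V) (card V) (\<lambda>(i,j). g (vertex_enum V i) (vertex_enum V j)))"

lemma vertex_enum_bij:
  assumes "finite V" shows "bij_betw (vertex_enum V) {..<card V} V"
  unfolding vertex_enum_def lessThan_atLeast0
  by (rule someI_ex[OF ex_bij_betw_nat_finite[OF assms]])

lemma vertex_enum_in: "finite V \<Longrightarrow> i < card V \<Longrightarrow> vertex_enum V i \<in> V"
  by (rule bij_betw_apply[OF vertex_enum_bij]) auto

lemma vertex_enum_eq_iff:
  "finite V \<Longrightarrow> i < card V \<Longrightarrow> j < card V \<Longrightarrow> vertex_enum V i = vertex_enum V j \<longleftrightarrow> i = j"
  by (rule inj_on_eq_iff[OF bij_betw_imp_inj_on[OF vertex_enum_bij]]) auto

text \<open>Permuting rows contributes the sign of \<open>p\<close>; permuting columns, done as rows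
  of the transpose, contributes it again, and the square of a sign is 1.\<close>

lemma det_permute_rows_cols:
  assumes "p permutes {0..<n}"
  shows "det (mat n n (\<lambda>(i,j). h (p i) (p j))) = det (mat n n (\<lambda>(i,j). h i j))"
proof -
  have lt: "p i < n" if "i < n" for i
    using permutes_in_image[OF assms, of i] that by simp
  let ?R = "mat n n (\<lambda>(i,j). h i (p j))"
  have "det (mat n n (\<lambda>(i,j). h (p i) (p j))) = det (mat n n (\<lambda>(i,j). ?R $$ (p i, j)))"
    by (rule arg_cong[where f = det]) (auto simp: lt)
  also have "\<dots> = signof p * det ?R"
    by (rule det_permute_rows[OF _ assms]) simp
  also have "det ?R = det (transpose_mat ?R)"
    by (rule det_transpose[symmetric, where n = n]) simp
  also have "transpose_mat ?R = mat n n (\<lambda>(i,j). (mat n n (\<lambda>(i,j). h j i)) $$ (p i, j))"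
    by (auto simp: lt)
  also have "det \<dots> = signof p * det (mat n n (\<lambda>(i,j). h j i))"
    by (rule det_permute_rows[OF _ assms]) simp
  also have "mat n n (\<lambda>(i,j). h j i) = transpose_mat (mat n n (\<lambda>(i,j). h i j))"
    by auto
  also have "det \<dots> = det (mat n n (\<lambda>(i,j). h i j))"
    by (rule det_transpose[where n = n]) simp
  finally show ?thesis
    by (simp add: mult.assoc[symmetric] sign_def)
qed

text \<open>Two enumerations of \<open>V\<close> differ by a permutation of positions, which acts on
  rows and columns simultaneously.\<close>

lemma set_det_enum:
  assumes e: "bij_betw e {..<n} V"
  shows "set_det V g = det (mat n n (\<lambda>(i,j). g (e i) (e j)))"
proof -
  have fin: "finite V" and n: "card V = n"
    using bij_betw_finite[OF e] bij_betw_same_card[OF e] by auto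
  let ?f = "vertex_enum V"
  have f: "bij_betw ?f {..<n} V" using vertex_enum_bij[OF fin] n by simp
  \<comment> \<open>\<open>p\<close> is the identity beyond \<open>n\<close>, as
    \<open>permutes\<close> demands.\<close>
  define p where "p i = (if i \<in> {..<n} then inv_into {..<n} ?f (e i) else i)" for i
  have "bij_betw (inv_into {..<n} ?f \<circ> e) {..<n} {..<n}"
    using e bij_betw_inv_into[OF f] by (rule bij_betw_trans)
  then have "bij_betw p {..<n} {..<n}"
    by (rule bij_betw_cong[THEN iffD1, rotated]) (simp add: p_def)
  then have p: "p permutes {0..<n}"
    unfolding lessThan_atLeast0[symmetric] by (rule bij_imp_permutes) (simp add: p_def)
  have fp: "?f (p i) = e i" if "i < n" for i
    using that bij_betw_inv_into_right[OF f bij_betw_apply[OF e]] by (simp add: p_def)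
  have "det (mat n n (\<lambda>(i,j). g (e i) (e j))) = det (mat n n (\<lambda>(i,j). g (?f (p i)) (?f (p j))))"
    by (rule arg_cong[where f = det]) (auto simp: fp)
  also have "\<dots> = set_det V g"
    unfolding set_det_def n by (rule det_permute_rows_cols[OF p])
  finally show ?thesis by simp
qed

lemma set_det_cong:
  assumes "finite V" "\<And>u v. u \<in> V \<Longrightarrow> v \<in> V \<Longrightarrow> g u v = h u v"
  shows "set_det V g = set_det V h"
  unfolding set_det_def
  by (rule arg_cong[where f = det]) (auto intro!: assms vertex_enum_in)

lemma set_det_image:
  assumes "finite V" "inj_on f V"
  shows "set_det (f ` V) g = set_det V (\<lambda>u v. g (f u) (f v))"
proof -
  have "bij_betw (f \<circ> vertex_enum V) {..<card V} (f ` V)"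
    using vertex_enum_bij[OF assms(1)] inj_on_imp_bij_betw[OF assms(2)] by (rule bij_betw_trans)
  from set_det_enum[OF this, of g] show ?thesis by (simp add: set_det_def)
qed

lemma sum_vertex_enum:
  "finite V \<Longrightarrow> (\<Sum>i = 0..<card V. F (vertex_enum V i)) = sum F V"
  unfolding lessThan_atLeast0[symmetric] by (rule sum.reindex_bij_betw[OF vertex_enum_bij])

lemma set_det_mult:
  assumes "finite V"
  shows "set_det V (\<lambda>u v. \<Sum>w\<in>V. g u w * h w v) = set_det V g * set_det V h"
  unfolding set_det_def
  by (subst det_mult[symmetric, where n = "card V"], simp, simp, rule arg_cong[where f = det])
     (auto simp: scalar_prod_def sum_vertex_enum[OF assms, symmetric])

lemma set_det_id:
  assumes "finite V"
  shows "set_det V (\<lambda>u v. if u = v then 1 else 0) = (1 :: 'c::comm_ring_1)"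
proof -
  have "mat (card V) (card V) (\<lambda>(i,j). if vertex_enum V i = vertex_enum V j then 1 else 0)
      = (1\<^sub>m (card V) :: 'c mat)"
    by (rule eq_matI) (auto simp: vertex_enum_eq_iff assms)
  then show ?thesis by (simp add: set_det_def)
qed

text \<open>Listing \<open>A\<close> before \<open>B\<close> makes the matrix block upper
  triangular.\<close>

lemma set_det_Un:
  fixes g :: "'a \<Rightarrow> 'a \<Rightarrow> 'c::idom"
  assumes fin: "finite A" "finite B" and disj: "A \<inter> B = {}"
    and zero: "\<And>u v. u \<in> B \<Longrightarrow> v \<in> A \<Longrightarrow> g u v = 0"
  shows "set_det (A \<union> B) g = set_det A g * set_det B g"
proof -
  let ?a = "card A" and ?b = "card B" and ?f = "vertex_enum A" and ?h = "vertex_enum B"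
  define e where "e i = (if i < ?a then ?f i else ?h (i - ?a))" for i
  have "bij_betw e {..<?a} A"
    using vertex_enum_bij[OF fin(1)] by (rule bij_betw_cong[THEN iffD1, rotated]) (simp add: e_def)
  moreover have "bij_betw e {?a..<?a + ?b} B"
  proof -
    have "bij_betw (\<lambda>i. i - ?a) {?a..<?a + ?b} {..<?b}"
      by (rule bij_betwI[where g = "\<lambda>i. i + ?a"]) auto
    then have "bij_betw (?h \<circ> (\<lambda>i. i - ?a)) {?a..<?a + ?b} B"
      using vertex_enum_bij[OF fin(2)] by (rule bij_betw_trans)
    then show ?thesis by (rule bij_betw_cong[THEN iffD1, rotated]) (simp add: e_def)
  qed
  ultimately have "bij_betw e ({..<?a} \<union> {?a..<?a + ?b}) (A \<union> B)"
    using disj by (rule bij_betw_combine)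
  also have "{..<?a} \<union> {?a..<?a + ?b} = {..<?a + ?b}" by auto
  finally have "set_det (A \<union> B) g = det (mat (?a + ?b) (?a + ?b) (\<lambda>(i,j). g (e i) (e j)))"
    by (rule set_det_enum)
  also have "mat (?a + ?b) (?a + ?b) (\<lambda>(i,j). g (e i) (e j)) = four_block_mat
      (mat ?a ?a (\<lambda>(i,j). g (?f i) (?f j))) (mat ?a ?b (\<lambda>(i,j). g (?f i) (?h j)))
      (0\<^sub>m ?b ?a) (mat ?b ?b (\<lambda>(i,j). g (?h i) (?h j)))"
    by (rule eq_matI) (auto simp: e_def Let_def intro!: zero vertex_enum_in fin)
  also have "det \<dots> = set_det A g * set_det B g"
    unfolding set_det_def by (rule det_four_block_mat_lower_left_zero) auto
  finally show ?thesis .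
qed

text \<open>The inverse is the adjugate divided by the determinant, carried back from positions to
  elements of \<open>V\<close>.\<close>

lemma set_det_right_inverse:
  fixes z :: "'a \<Rightarrow> 'a \<Rightarrow> 'c::field"
  assumes fin: "finite V" and nz: "set_det V z \<noteq> 0"
  obtains w where
    "\<And>u v. u \<in> V \<Longrightarrow> v \<in> V \<Longrightarrow> (\<Sum>x\<in>V. z u x * w x v) = (if u = v then 1 else 0)"
proof -
  let ?n = "card V" and ?f = "vertex_enum V"
  define A where "A = mat ?n ?n (\<lambda>(i,j). z (?f i) (?f j))"
  define B where "B = adj_mat A"
  have A: "A \<in> carrier_mat ?n ?n" and d: "det A \<noteq> 0"
    using nz by (auto simp: A_def set_det_def)
  note B = adj_mat[OF A, folded B_def]
  define k where "k = inv_into {..<?n} ?f"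
  have f: "bij_betw ?f {..<?n} V" by (rule vertex_enum_bij[OF fin])
  have kf [simp]: "k (?f i) = i" if "i < ?n" for i
    unfolding k_def using that f by (auto simp: bij_betw_def)
  define w where "w u v = B $$ (k u, k v) / det A" for u v
  show thesis
  proof (rule that[of w])
    fix u v assume "u \<in> V" "v \<in> V"
    then obtain i j where ij: "u = ?f i" "v = ?f j" "i < ?n" "j < ?n"
      using bij_betw_imp_surj_on[OF f] by (metis imageE lessThan_iff)
    have "(\<Sum>x\<in>V. z u x * w x v) = (\<Sum>l = 0..<?n. A $$ (i,l) * B $$ (l,j)) / det A"
      unfolding sum_vertex_enum[OF fin, symmetric] sum_divide_distrib
      by (rule sum.cong) (auto simp: ij A_def w_def)
    also have "(\<Sum>l = 0..<?n. A $$ (i,l) * B $$ (l,j)) = (A * B) $$ (i,j)"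
      using A B(1) ij by (auto simp: scalar_prod_def)
    finally show "(\<Sum>x\<in>V. z u x * w x v) = (if u = v then 1 else 0)"
      using ij d by (simp add: B(2) vertex_enum_eq_iff[OF fin])
  qed
qed

text \<open>This is the determinant of diag(q, ..., q). Induction on \<open>V0\<close> splits off
  one fibre at a time; entries between different fibres vanish.\<close>

lemma set_det_block_diag:
  fixes q :: "'b \<Rightarrow> 'b \<Rightarrow> 'c::idom"
  assumes "finite V0" "finite V1"
  shows "set_det (V0 \<times> V1) (\<lambda>x y. if fst x = fst y then q (snd x) (snd y) else 0)
       = set_det V1 q ^ card V0"
  using assms(1)
proof (induction V0)
  case empty
  show ?case by (simp add: set_det_def)
next
  case (insert v V)
  let ?g = "\<lambda>x y. if fst x = fst y then q (snd x) (snd y) else 0"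
  have "set_det (insert v V \<times> V1) ?g = set_det (Pair v ` V1 \<union> V \<times> V1) ?g"
    by (rule arg_cong[where f = "\<lambda>X. set_det X ?g"]) auto
  also have "\<dots> = set_det (Pair v ` V1) ?g * set_det (V \<times> V1) ?g"
    using insert.hyps assms(2) by (intro set_det_Un) auto
  also have "set_det (Pair v ` V1) ?g = set_det V1 q"
    by (subst set_det_image[OF assms(2)]) (auto simp: inj_on_def)
  finally show ?case using insert by simp
qed

section \<open>Replacing the copies in a corona-shaped matrix\<close>

text \<open>The position inside a copy enters only through \<open>a * z\<close> on the diagonal copy
  blocks. All other entries depend on the roots alone, so each other block meeting a copy is
  constant.\<close>

definition corona_kernel :: "('a \<Rightarrow> 'a \<Rightarrow> real) \<Rightarrow> ('a \<Rightarrow> 'a \<Rightarrow> real) \<Rightarrow> ('a \<Rightarrow> 'a \<Rightarrow> real)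
    \<Rightarrow> real \<Rightarrow> ('b \<Rightarrow> 'b \<Rightarrow> real) \<Rightarrow> ('a + 'a \<times> 'b) \<Rightarrow> ('a + 'a \<times> 'b) \<Rightarrow> real" where
  "corona_kernel g h b a z x y = (case x of
     Inl v \<Rightarrow> (case y of Inl v' \<Rightarrow> g v v' | Inr (v',_) \<Rightarrow> h v v')
   | Inr (v,u) \<Rightarrow> (case y of Inl v' \<Rightarrow> h v v'
       | Inr (v',u') \<Rightarrow> b v v' + (if v = v' then a * z u u' else 0)))"

lemma corona_V_eq: "corona_V V0 V1 = Inl ` V0 \<union> Inr ` (V0 \<times> V1)"
  by (auto simp: corona_V_def)

lemma finite_corona_V: "finite V0 \<Longrightarrow> finite V1 \<Longrightarrow> finite (corona_V V0 V1)"
  by (simp add: corona_V_def)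

lemma sum_corona_V:
  assumes "finite V0" "finite V1"
  shows "sum F (corona_V V0 V1) = (\<Sum>v\<in>V0. F (Inl v)) + (\<Sum>v\<in>V0. \<Sum>u\<in>V1. F (Inr (v,u)))"
  unfolding corona_V_eq using assms
  by (subst sum.union_disjoint)
     (auto simp: sum.reindex inj_on_def sum.cartesian_product case_prod_unfold)

text \<open>With \<open>q\<close> the product of the inverse of \<open>z\<close> and
  \<open>z'\<close>, right multiplication by diag(I, q, ..., q) turns \<open>z\<close> into
  \<open>z'\<close>. It fixes constant rows because the columns of \<open>q\<close> sum to 1, and it
  has determinant 1.\<close>

lemma set_det_corona_kernel_exchange:
  assumes fin: "finite V0" "finite V1"
    and det_eq: "set_det V1 z = set_det V1 z'" and nz: "set_det V1 z \<noteq> 0"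
    and col: "\<And>v. v \<in> V1 \<Longrightarrow> (\<Sum>u\<in>V1. z u v) = s"
    and col': "\<And>v. v \<in> V1 \<Longrightarrow> (\<Sum>u\<in>V1. z' u v) = s"
  shows "set_det (corona_V V0 V1) (corona_kernel g h b a z)
       = set_det (corona_V V0 V1) (corona_kernel g h b a z')"
proof -
  obtain w where w: "\<And>u v. u \<in> V1 \<Longrightarrow> v \<in> V1 \<Longrightarrow> (\<Sum>x\<in>V1. z u x * w x v) = (if u = v then 1 else 0)"
    using set_det_right_inverse[OF fin(2) nz] by blast
  define q where "q u v = (\<Sum>x\<in>V1. w u x * z' x v)" for u v
  have zq: "(\<Sum>x\<in>V1. z u x * q x v) = z' u v" if "u \<in> V1" "v \<in> V1" for u v
  proof -
    have "(\<Sum>x\<in>V1. z u x * q x v) = (\<Sum>y\<in>V1. (\<Sum>x\<in>V1. z u x * w x y) * z' y v)"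
      unfolding q_def sum_distrib_left sum_distrib_right
      by (subst sum.swap) (simp add: mult.assoc)
    also have "\<dots> = (\<Sum>y\<in>V1. if u = y then z' y v else 0)"
      by (rule sum.cong) (use w[OF that(1)] in auto)
    finally show ?thesis using that fin by simp
  qed
  have "set_det V1 z' = set_det V1 (\<lambda>u v. \<Sum>x\<in>V1. z u x * q x v)"
    by (rule set_det_cong[OF fin(2)]) (simp add: zq)
  then have "set_det V1 z * set_det V1 q = set_det V1 z"
    by (simp add: set_det_mult[OF fin(2)] det_eq)
  then have det_q: "set_det V1 q = 1" using nz by simp
  \<comment> \<open>Summing the identity z w = I down a column. In particular \<open>s\<close> is
    nonzero as soon as \<open>V1\<close> has an element, which permits the cancellation in
    \<open>col_q\<close>.\<close>
  have col_w: "s * (\<Sum>u\<in>V1. w u v) = 1" if "v \<in> V1" for v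
  proof -
    have "s * (\<Sum>x\<in>V1. w x v) = (\<Sum>x\<in>V1. (\<Sum>u\<in>V1. z u x) * w x v)"
      by (simp add: sum_distrib_left col)
    also have "\<dots> = (\<Sum>u\<in>V1. \<Sum>x\<in>V1. z u x * w x v)"
      unfolding sum_distrib_right by (rule sum.swap)
    also have "\<dots> = (\<Sum>u\<in>V1. if u = v then 1 else 0)"
      by (rule sum.cong) (use w that in auto)
    finally show ?thesis using that fin by simp
  qed
  have col_q: "(\<Sum>u\<in>V1. q u v) = 1" if "v \<in> V1" for v
  proof -
    have s: "s \<noteq> 0" using col_w[OF that] by auto
    have "s * (\<Sum>u\<in>V1. q u v) = (\<Sum>x\<in>V1. (s * (\<Sum>u\<in>V1. w u x)) * z' x v)"
      unfolding q_def sum_distrib_left sum_distrib_right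
      by (subst sum.swap) (simp add: mult.assoc)
    also have "\<dots> = s" by (simp add: col_w col' that)
    finally show ?thesis using s by simp
  qed
  \<comment> \<open>\<open>D\<close> is diag(I, q, ..., q): the identity on roots and
    \<open>q\<close> on each copy.\<close>
  define D :: "('a + 'a \<times> 'b) \<Rightarrow> ('a + 'a \<times> 'b) \<Rightarrow> real" where
    "D x y = (case x of
         Inl v \<Rightarrow> (case y of Inl v' \<Rightarrow> if v = v' then 1 else 0 | Inr _ \<Rightarrow> 0)
       | Inr (v,u) \<Rightarrow> (case y of Inl _ \<Rightarrow> 0 | Inr (v',u') \<Rightarrow> if v = v' then q u u' else 0))" for x y
  let ?K = "corona_kernel g h b a z" and ?K' = "corona_kernel g h b a z'"
  have det_D: "set_det (corona_V V0 V1) D = 1"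
  proof -
    have "set_det (corona_V V0 V1) D = set_det (Inl ` V0) D * set_det (Inr ` (V0 \<times> V1)) D"
      unfolding corona_V_eq using fin by (intro set_det_Un) (auto simp: D_def)
    also have "set_det (Inl ` V0) D = 1"
      using fin by (subst set_det_image) (auto simp: D_def set_det_id)
    also have "set_det (Inr ` (V0 \<times> V1)) D
        = set_det (V0 \<times> V1) (\<lambda>x y. if fst x = fst y then q (snd x) (snd y) else 0)"
      using fin by (subst set_det_image) (auto simp: D_def case_prod_unfold)
    also have "\<dots> = 1" using fin by (simp add: set_det_block_diag det_q)
    finally show ?thesis by simp
  qed
  have "(\<Sum>w\<in>corona_V V0 V1. ?K x w * D w y) = ?K' x y"
    if x: "x \<in> corona_V V0 V1" and y: "y \<in> corona_V V0 V1" for x y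
  proof (cases y)
    case (Inl v)
    then have v: "v \<in> V0" using y by (auto simp: corona_V_eq)
    \<comment> \<open>A root column of \<open>D\<close> is a unit vector, and \<open>z\<close> does
      not occur in root columns of the kernel.\<close>
    have "(\<Sum>w\<in>corona_V V0 V1. ?K x w * D w y) = (\<Sum>v'\<in>V0. if v' = v then ?K x (Inl v') else 0)"
      using fin by (simp add: sum_corona_V D_def Inl if_distrib cong: if_cong)
    also have "\<dots> = ?K' x y"
      using v fin by (simp add: Inl corona_kernel_def split: sum.split prod.split)
    finally show ?thesis .
  next
    case (Inr p)
    then obtain v u where p: "y = Inr (v,u)" and v: "v \<in> V0" "u \<in> V1"
      using y by (auto simp: corona_V_eq)
    have "(\<Sum>w\<in>corona_V V0 V1. ?K x w * D w y)
        = (\<Sum>v'\<in>V0. \<Sum>u'\<in>V1. ?K x (Inr (v',u')) * (if v' = v then q u' u else 0))"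
      using fin by (simp add: sum_corona_V D_def p)
    also have "\<dots> = (\<Sum>v'\<in>V0. if v' = v then (\<Sum>u'\<in>V1. ?K x (Inr (v',u')) * q u' u) else 0)"
      by (rule sum.cong) auto
    also have "\<dots> = (\<Sum>u'\<in>V1. ?K x (Inr (v,u')) * q u' u)" using v fin by simp
    also have "\<dots> = ?K' x y"
    \<comment> \<open>In a root row the entries along the copy are constant, so column sum 1
      reproduces them. In a copy row the same holds for the summand \<open>b\<close>, while
      \<open>zq\<close> converts the summand \<open>a * z\<close>.\<close>
    proof (cases x)
      case (Inl v')
      then show ?thesis
        by (simp add: corona_kernel_def p sum_distrib_left[symmetric] col_q v)
    next
      case (Inr p')
      then obtain v' u' where p': "x = Inr (v',u')" and u': "u' \<in> V1"
        using x by (auto simp: corona_V_eq)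
      show ?thesis
        using zq[OF u' v(2)]
        by (simp add: corona_kernel_def p p' distrib_right sum.distrib mult.assoc
            sum_distrib_left[symmetric] col_q v)
    qed
    finally show ?thesis .
  qed
  then have "set_det (corona_V V0 V1) ?K'
      = set_det (corona_V V0 V1) (\<lambda>x y. \<Sum>w\<in>corona_V V0 V1. ?K x w * D w y)"
    by (intro set_det_cong finite_corona_V fin) simp
  then show ?thesis
    using set_det_mult[OF finite_corona_V[OF fin], of ?K D] det_D by simp
qed

section \<open>Characteristic polynomials\<close>

text \<open>A monic complex polynomial is the product of the linear factors of its root multiset,
  and embedding real coefficients into the complex numbers is injective.\<close>

lemma spectrum_mset_eq_iff:
  assumes A: "A \<in> carrier_mat n n" and B: "B \<in> carrier_mat n' n'"
  shows "spectrum_mset A = spectrum_mset B \<longleftrightarrow> char_poly A = char_poly B"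
proof -
  have hom: "char_poly (map_mat complex_of_real X) = map_poly complex_of_real (char_poly X)"
    if "X \<in> carrier_mat l l" for X l
    using that by (rule of_real_hom.char_poly_hom)
  have decomp: "(\<Prod>x\<in>#spectrum_mset X. [:-x, 1:]) = map_poly complex_of_real (char_poly X)"
    if X: "X \<in> carrier_mat l l" for X l
  proof -
    let ?X = "map_mat complex_of_real X"
    have "lead_coeff (char_poly ?X) = 1"
      using degree_monic_char_poly[of ?X l] X by simp
    then show ?thesis
      using complex_poly_decompose_multiset[of "char_poly ?X"]
      by (simp add: spectrum_mset_def hom[OF X])
  qed
  show ?thesis
  proof
    assume "spectrum_mset A = spectrum_mset B"
    then have "map_poly complex_of_real (char_poly A) = map_poly complex_of_real (char_poly B)"
      using decomp[OF A] decomp[OF B] by simp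
    then show "char_poly A = char_poly B"
      by (simp add: poly_eq_iff coeff_map_poly)
  next
    assume "char_poly A = char_poly B"
    then show "spectrum_mset A = spectrum_mset B"
      by (simp add: spectrum_mset_def hom[OF A] hom[OF B])
  qed
qed

text \<open>Evaluating at a point replaces a determinant over polynomials by one over the reals,
  where \<open>z\<close> can be inverted.\<close>

lemma poly_char_poly_enum:
  assumes "finite V"
  shows "poly (char_poly (mat (card V) (card V) (\<lambda>(i,j). g (vertex_enum V i) (vertex_enum V j)))) x
       = set_det V (\<lambda>u v. (if u = v then x else 0) - (g u v :: real))"
proof -
  let ?A = "mat (card V) (card V) (\<lambda>(i,j). g (vertex_enum V i) (vertex_enum V j))"
  show ?thesis
    unfolding set_det_def
    by (subst char_poly_matrix[where n = "card V"], simp, rule arg_cong[where f = det])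
       (auto intro!: eq_matI simp: char_matrix_def vertex_enum_eq_iff[OF assms])
qed

section \<open>Adjacency and Seidel entries indexed by vertices\<close>

definition adj_fun :: "'a set set \<Rightarrow> 'a \<Rightarrow> 'a \<Rightarrow> real" where
  "adj_fun E u v = (if u = v then 0 else real (card {e\<in>E. u \<in> e \<and> v \<in> e}))"

definition seidel_fun :: "'a set set \<Rightarrow> 'a \<Rightarrow> 'a \<Rightarrow> real" where
  "seidel_fun E u v = (if u = v then 0 else 1 - 2 * adj_fun E u v)"

lemma adj_matrix_carrier: "adj_matrix V E \<in> carrier_mat (card V) (card V)"
  by (simp add: adj_matrix_def)

lemma seidel_matrix_carrier: "seidel_matrix V E \<in> carrier_mat (card V) (card V)"
  by (rule carrier_matI) (simp_all add: seidel_matrix_def Let_def adj_matrix_def)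

lemma adj_matrix_enum:
  assumes "finite V"
  shows "adj_matrix V E
       = mat (card V) (card V) (\<lambda>(i,j). adj_fun E (vertex_enum V i) (vertex_enum V j))"
  by (rule eq_matI) (auto simp: adj_matrix_def adj_fun_def vertex_enum_eq_iff[OF assms])

lemma seidel_matrix_enum:
  assumes "finite V"
  shows "seidel_matrix V E
       = mat (card V) (card V) (\<lambda>(i,j). seidel_fun E (vertex_enum V i) (vertex_enum V j))"
  by (rule eq_matI)
     (auto simp: seidel_matrix_def Let_def adj_matrix_def adj_fun_def seidel_fun_def
       vertex_enum_eq_iff[OF assms])

lemma poly_char_poly_adj:
  assumes "finite V"
  shows "poly (char_poly (adj_matrix V E)) x
       = set_det V (\<lambda>u v. (if u = v then x else 0) - adj_fun E u v)"
  unfolding adj_matrix_enum[OF assms] by (rule poly_char_poly_enum[OF assms])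

lemma poly_char_poly_seidel:
  assumes "finite V"
  shows "poly (char_poly (seidel_matrix V E)) x
       = set_det V (\<lambda>u v. (if u = v then x else 0) - seidel_fun E u v)"
  unfolding seidel_matrix_enum[OF assms] by (rule poly_char_poly_enum[OF assms])

section \<open>Counting hyperedges\<close>

text \<open>Removing \<open>T\<close> is a bijection onto the subsets of \<open>X - T\<close> of
  size \<open>k - card T\<close>. For \<open>card T > k\<close> truncated subtraction would give 1
  although no such set exists.\<close>

lemma card_subsets_containing:
  assumes "finite X" "T \<subseteq> X" "card T \<le> k"
  shows "card {S. S \<subseteq> X \<and> card S = k \<and> T \<subseteq> S} = (card X - card T) choose (k - card T)"
proof -
  have T: "finite T" using assms finite_subset by blast
  have "bij_betw (\<lambda>S. S \<union> T) {R. R \<subseteq> X - T \<and> card R = k - card T}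
      {S. S \<subseteq> X \<and> card S = k \<and> T \<subseteq> S}"
  proof (rule bij_betwI[where g = "\<lambda>S. S - T"])
    show "(\<lambda>S. S \<union> T) \<in> {R. R \<subseteq> X - T \<and> card R = k - card T}
        \<rightarrow> {S. S \<subseteq> X \<and> card S = k \<and> T \<subseteq> S}"
    proof clarify
      fix R assume R: "R \<subseteq> X - T" "card R = k - card T"
      then have "card (R \<union> T) = card R + card T"
        using T assms(1) by (intro card_Un_disjoint) (auto intro: finite_subset)
      then show "R \<union> T \<subseteq> X \<and> card (R \<union> T) = k \<and> T \<subseteq> R \<union> T"
        using R assms by auto
    qed
    show "(\<lambda>S. S - T) \<in> {S. S \<subseteq> X \<and> card S = k \<and> T \<subseteq> S}
        \<rightarrow> {R. R \<subseteq> X - T \<and> card R = k - card T}"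
      using T by (auto simp: card_Diff_subset)
  qed auto
  then have "card {S. S \<subseteq> X \<and> card S = k \<and> T \<subseteq> S}
      = card {R. R \<subseteq> X - T \<and> card R = k - card T}"
    by (simp add: bij_betw_same_card)
  also have "\<dots> = (card X - card T) choose (k - card T)"
    using assms T by (simp add: n_subsets card_Diff_subset)
  finally show ?thesis .
qed

section \<open>Regular uniform hypergraphs: column sums and the complete case\<close>

lemma uniform_hg_edges:
  assumes "uniform_hg k V E"
  shows "finite V" "finite E" "\<And>e. e \<in> E \<Longrightarrow> e \<subseteq> V" "\<And>e. e \<in> E \<Longrightarrow> card e = k"
proof -
  show "finite V" and sub: "\<And>e. e \<in> E \<Longrightarrow> e \<subseteq> V" and "\<And>e. e \<in> E \<Longrightarrow> card e = k"
    using assms by (auto simp: uniform_hg_def hypergraph_def)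
  have "E \<subseteq> Pow V" using sub by auto
  then show "finite E" using \<open>finite V\<close> by (simp add: finite_subset)
qed

lemma adj_fun_sym: "adj_fun E u v = adj_fun E v u"
  by (auto simp: adj_fun_def conj_commute)

text \<open>Double counting of pairs of a hyperedge through \<open>v\<close> and another vertex on
  it: each of the \<open>r\<close> hyperedges contributes \<open>k - 1\<close>.\<close>

lemma sum_adj_fun_regular:
  assumes "regular_hg k r V E" and v: "v \<in> V"
  shows "(\<Sum>u\<in>V. adj_fun E u v) = real (r * (k - 1))"
proof -
  have "uniform_hg k V E" using assms by (simp add: regular_hg_def)
  note E = uniform_hg_edges[OF this]
  let ?Ev = "{e\<in>E. v \<in> e}"
  have card_other: "card {u \<in> V - {v}. u \<in> e} = k - 1" if "e \<in> ?Ev" for e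
  proof -
    have "{u \<in> V - {v}. u \<in> e} = e - {v}" using that E(3) by auto
    then show ?thesis using that E(4) by (simp add: card_Diff_singleton)
  qed
  have "(\<Sum>u\<in>V. adj_fun E u v) = (\<Sum>u\<in>V - {v}. adj_fun E u v)"
    using E(1) v by (simp add: sum.remove adj_fun_def)
  also have "\<dots> = real (\<Sum>u\<in>V - {v}. card {e\<in>?Ev. u \<in> e})"
    unfolding of_nat_sum by (rule sum.cong) (auto simp: adj_fun_def intro!: arg_cong[where f = card])
  also have "(\<Sum>u\<in>V - {v}. card {e\<in>?Ev. u \<in> e}) = (\<Sum>e\<in>?Ev. k - 1)"
    using E(1,2) card_other by (intro sum_multicount_gen) auto
  also have "\<dots> = r * (k - 1)"
    using assms by (simp add: regular_hg_def hdegree_def)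
  finally show ?thesis .
qed

text \<open>Through a vertex \<open>v\<close> of any \<open>k\<close>-set \<open>S\<close> there are
  only \<open>(card V - 1) choose (k - 1)\<close> sets of size \<open>k\<close>. With
  \<open>r\<close> at least that number all of them, hence also \<open>S\<close>, are
  hyperedges.\<close>

lemma regular_hg_complete:
  assumes reg: "regular_hg k r V E" and r: "(card V - 1) choose (k - 1) \<le> r" and k: "k \<ge> 1"
  shows "E = {S. S \<subseteq> V \<and> card S = k}"
proof -
  have "uniform_hg k V E" using reg by (simp add: regular_hg_def)
  note E = uniform_hg_edges[OF this]
  have "S \<in> E" if S: "S \<subseteq> V" "card S = k" for S
  proof -
    obtain v where v: "v \<in> S" using S k by fastforce
    let ?T = "{S. S \<subseteq> V \<and> card S = k \<and> {v} \<subseteq> S}"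
    have "card ?T = (card V - 1) choose (k - 1)"
      using E(1) k v S by (subst card_subsets_containing) auto
    moreover have "card {e\<in>E. v \<in> e} = r"
      using reg v S by (auto simp: regular_hg_def hdegree_def)
    ultimately have "{e\<in>E. v \<in> e} = ?T"
      using E r by (intro card_seteq) auto
    then show ?thesis using S v by auto
  qed
  then show ?thesis using E by auto
qed

text \<open>Otherwise both hypergraphs are complete, and every bijection of their vertex sets is an
  isomorphism.\<close>

lemma regular_hg_not_complete:
  assumes "regular_hg k r V E" "regular_hg k r W F" and card: "card V = card W" and k: "k \<ge> 1"
    and niso: "\<not> hg_isomorphic V E W F"
  shows "r < (card V - 1) choose (k - 1)"
proof (rule ccontr)
  assume "\<not> ?thesis"
  then have E: "E = {S. S \<subseteq> V \<and> card S = k}" and F: "F = {S. S \<subseteq> W \<and> card S = k}"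
    using regular_hg_complete[OF assms(1)] regular_hg_complete[OF assms(2)] card k by auto
  have "finite V" "finite W"
    using assms(1,2) by (auto simp: regular_hg_def uniform_hg_def hypergraph_def)
  then obtain f where f: "bij_betw f V W"
    using card finite_same_card_bij by blast
  have "e \<in> E \<longleftrightarrow> f ` e \<in> F" if "e \<subseteq> V" for e
  proof -
    have "card (f ` e) = card e"
      using f that by (meson bij_betw_def card_image inj_on_subset)
    moreover have "f ` e \<subseteq> W" using f that by (auto simp: bij_betw_def)
    ultimately show ?thesis using that by (simp add: E F)
  qed
  then show False using f niso unfolding hg_isomorphic_def by blast
qed

section \<open>Hyperedges of the corona\<close>

abbreviation copy :: "'a \<Rightarrow> 'b set \<Rightarrow> ('a + 'a \<times> 'b) set" where
  "copy v U \<equiv> (\<lambda>u. Inr (v,u)) ` U"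

lemma inj_copy: "inj (copy v)"
  by (rule injI) (simp add: inj_image_eq_iff inj_def)

lemma card_root_copy: "finite U \<Longrightarrow> card (insert (Inl v) (copy v U)) = card U + 1"
  by (subst card_insert_disjoint) (auto simp: card_image inj_on_def)

text \<open>A set of at least two elements inside root and copy automatically meets the copy.
  Without that condition the new hyperedges become sets that \<open>card_subsets_containing\<close>
  can count.\<close>

lemma corona_E_eq:
  assumes "k \<ge> 2"
  shows "corona_E k V0 E0 V1 E1 = image Inl ` E0 \<union> (\<Union>v\<in>V0. copy v ` E1)
      \<union> (\<Union>v\<in>V0. {S. S \<subseteq> insert (Inl v) (copy v V1) \<and> card S = k \<and> {Inl v} \<subseteq> S})"
proof -
  have "S \<inter> copy v V1 \<noteq> {}"
    if "S \<subseteq> insert (Inl v) (copy v V1)" "card S = k" for S and v :: 'a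
  proof
    assume "S \<inter> copy v V1 = {}"
    then have "S \<subseteq> {Inl v}" using that by auto
    then have "card S \<le> 1" using card_mono[of "{Inl v}" S] by simp
    then show False using that assms by simp
  qed
  then show ?thesis unfolding corona_E_def by auto
qed

lemma finite_corona_E:
  assumes "finite V0" "finite E0" "finite V1" "finite E1" "k \<ge> 2"
  shows "finite (corona_E k V0 E0 V1 E1)"
  unfolding corona_E_eq[OF assms(5)] using assms by auto

text \<open>Only hyperedges of copy \<open>v\<close> and new hyperedges at \<open>v\<close> reach
  into that copy; the latter contain the root and the former do not. A singleton \<open>T\<close>
  yields degrees, a pair yields adjacencies.\<close>

lemma card_corona_edges_copy:
  assumes k: "k \<ge> 2" and fin: "finite V1" "finite E1" and v: "v \<in> V0" and T: "T \<noteq> {}"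
  shows "card {e \<in> corona_E k V0 E0 V1 E1. copy v T \<subseteq> e}
       = card {e\<in>E1. T \<subseteq> e}
       + card {S. S \<subseteq> insert (Inl v) (copy v V1) \<and> card S = k \<and> insert (Inl v) (copy v T) \<subseteq> S}"
proof -
  let ?R = "{S. S \<subseteq> insert (Inl v) (copy v V1) \<and> card S = k \<and> insert (Inl v) (copy v T) \<subseteq> S}"
  obtain u where u: "u \<in> T" using T by auto
  let ?C = "copy v ` {e\<in>E1. T \<subseteq> e}"
  have "e \<in> ?C \<union> ?R" if e: "e \<in> corona_E k V0 E0 V1 E1" "copy v T \<subseteq> e" for e
  proof -
    have ue: "Inr (v,u) \<in> e" using e(2) u by auto
    from e(1)[unfolded corona_E_eq[OF k]] show ?thesis
    proof (elim UnE UN_E)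
      assume "e \<in> image Inl ` E0"
      then show ?thesis using ue by auto
    next
      fix w assume "e \<in> copy w ` E1"
      then obtain e1 where e1: "e1 \<in> E1" "e = copy w e1" by (rule imageE)
      have "w = v" using ue e1(2) by auto
      moreover have "T \<subseteq> e1" using e(2) e1(2) by auto
      ultimately show ?thesis using e1 by (intro UnI1 image_eqI[where x = e1]) simp_all
    next
      fix w assume "e \<in> {S. S \<subseteq> insert (Inl w) (copy w V1) \<and> card S = k \<and> {Inl w} \<subseteq> S}"
      then have join: "e \<subseteq> insert (Inl w) (copy w V1)" "card e = k" "Inl w \<in> e" by simp_all
      have "w = v" using subsetD[OF join(1) ue] by auto
      then show ?thesis using join e(2) by simp
    qed
  qed
  then have "{e \<in> corona_E k V0 E0 V1 E1. copy v T \<subseteq> e} \<subseteq> ?C \<union> ?R"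
    by (intro subsetI) simp
  moreover have "?C \<subseteq> {e \<in> corona_E k V0 E0 V1 E1. copy v T \<subseteq> e}"
    unfolding corona_E_eq[OF k] using v by auto
  moreover have "?R \<subseteq> {e \<in> corona_E k V0 E0 V1 E1. copy v T \<subseteq> e}"
    unfolding corona_E_eq[OF k] using v by auto
  ultimately have "{e \<in> corona_E k V0 E0 V1 E1. copy v T \<subseteq> e} = ?C \<union> ?R"
    by (intro equalityI Un_least)
  also have "card \<dots> = card (copy v ` {e\<in>E1. T \<subseteq> e}) + card ?R"
    using fin by (intro card_Un_disjoint) auto
  also have "card (copy v ` {e\<in>E1. T \<subseteq> e}) = card {e\<in>E1. T \<subseteq> e}"
    by (rule card_image) (rule inj_on_subset[OF inj_copy], simp)
  finally show ?thesis .
qed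

lemma card_subsets_containing_root_copy:
  assumes "finite V1" "T \<subseteq> V1" "card T + 1 \<le> k"
  shows "card {S. S \<subseteq> insert (Inl v) (copy v V1) \<and> card S = k \<and> insert (Inl v) (copy v T) \<subseteq> S}
       = (card V1 - card T) choose (k - 1 - card T)"
proof -
  have "finite T" using assms finite_subset by blast
  then show ?thesis
    using assms by (subst card_subsets_containing) (auto simp: card_root_copy)
qed

text \<open>The number of new hyperedges through two given vertices of one copy. They also contain the
  root, so there are none for $k = 2$, where truncated subtraction would give $1$.\<close>

definition copy_shift :: "nat \<Rightarrow> nat \<Rightarrow> nat" where
  "copy_shift k m = (if k \<ge> 3 then (m - 2) choose (k - 3) else 0)"

section \<open>Adjacencies in the corona\<close>

lemma adj_fun_corona_Inl_Inl:
  assumes "k \<ge> 2"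
  shows "adj_fun (corona_E k V0 E0 V1 E1) (Inl v) (Inl v') = adj_fun E0 v v'"
proof (cases "v = v'")
  case False
  then have "{e \<in> corona_E k V0 E0 V1 E1. Inl v \<in> e \<and> Inl v' \<in> e}
      = image Inl ` {e\<in>E0. v \<in> e \<and> v' \<in> e}"
    unfolding corona_E_eq[OF assms] by auto
  moreover have "inj (image Inl :: 'a set \<Rightarrow> ('a + 'a \<times> 'b) set)"
    by (rule injI) (simp add: inj_image_eq_iff)
  ultimately show ?thesis
    using False by (simp add: adj_fun_def card_image inj_on_subset)
qed (simp add: adj_fun_def)

text \<open>Only new hyperedges join a root to a copy, and only to its own; \<open>k - 2\<close>
  further vertices are chosen from the rest of the copy.\<close>

lemma adj_fun_corona_Inl_Inr:
  assumes k: "k \<ge> 2" and fin: "finite V1" and "v' \<in> V0" "u \<in> V1"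
  shows "adj_fun (corona_E k V0 E0 V1 E1) (Inl v) (Inr (v',u))
       = (if v = v' then real ((card V1 - 1) choose (k - 2)) else 0)"
proof -
  have "{e \<in> corona_E k V0 E0 V1 E1. Inl v \<in> e \<and> Inr (v',u) \<in> e}
      = (if v = v' then {S. S \<subseteq> insert (Inl v) (copy v V1) \<and> card S = k
            \<and> insert (Inl v) (copy v {u}) \<subseteq> S} else {})"
    unfolding corona_E_eq[OF k] using assms by auto
  then show ?thesis
    using card_subsets_containing_root_copy[OF fin, of "{u}" k v'] assms
    by (simp add: adj_fun_def numeral_2_eq_2)
qed

lemma adj_fun_corona_Inr_Inr:
  assumes k: "k \<ge> 2" and fin: "finite V1" "finite E1" and "v \<in> V0" "v' \<in> V0" "u \<in> V1" "u' \<in> V1"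
    and ne: "(v,u) \<noteq> (v',u')"
  shows "adj_fun (corona_E k V0 E0 V1 E1) (Inr (v,u)) (Inr (v',u'))
       = (if v = v' then adj_fun E1 u u' + real (copy_shift k (card V1)) else 0)"
proof (cases "v = v'")
  case False
  then have empty: "{e \<in> corona_E k V0 E0 V1 E1. Inr (v,u) \<in> e \<and> Inr (v',u') \<in> e} = {}"
    unfolding corona_E_eq[OF k] by auto
  show ?thesis unfolding adj_fun_def empty using False by simp
next
  case True
  with ne have u: "u \<noteq> u'" by simp
  let ?R = "{S. S \<subseteq> insert (Inl v) (copy v V1) \<and> card S = k
    \<and> insert (Inl v) (copy v {u,u'}) \<subseteq> S}"
  have "card ?R = copy_shift k (card V1)"
  proof (cases "k \<ge> 3")
    case True
    then show ?thesis
      using card_subsets_containing_root_copy[OF fin(1), of "{u,u'}" k v] assms u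
      by (simp add: copy_shift_def numeral_eq_Suc)
  next
    case False
    \<comment> \<open>Here \<open>k = 2\<close>, but root and two copy vertices already make three
      elements.\<close>
    have "?R = {}"
    proof (rule equals0I, clarify)
      fix S assume S: "S \<subseteq> insert (Inl v) (copy v V1)" "k = card S"
        "insert (Inl v) (copy v {u,u'}) \<subseteq> S"
      have "card (insert (Inl v) (copy v {u,u'})) \<le> card S"
        using S fin by (intro card_mono) (auto intro: finite_subset)
      then show False using u False S(2) by (simp add: card_root_copy del: image_insert)
    qed
    then show ?thesis using False by (simp only: card.empty copy_shift_def) simp
  qed
  then show ?thesis
    using card_corona_edges_copy[OF k fin \<open>v \<in> V0\<close>, of "{u,u'}" E0] u True
    by (simp add: adj_fun_def)
qed

section \<open>Degrees in the corona\<close>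

lemma corona_not_regular:
  assumes unif: "uniform_hg k V0 E0" and reg: "regular_hg k r V1 E1" and k: "k \<ge> 2"
    and "V0 \<noteq> {}" and m: "card V1 \<ge> 1" and r: "r < (card V1 - 1) choose (k - 1)"
  shows "\<not> is_regular (corona_V V0 V1) (corona_E k V0 E0 V1 E1)"
proof
  let ?E = "corona_E k V0 E0 V1 E1"
  assume "is_regular (corona_V V0 V1) ?E"
  then obtain d where d: "\<And>x. x \<in> corona_V V0 V1 \<Longrightarrow> hdegree ?E x = d"
    by (auto simp: is_regular_def)
  have unif1: "uniform_hg k V1 E1" using reg by (simp add: regular_hg_def)
  note E0 = uniform_hg_edges[OF unif] and E1 = uniform_hg_edges[OF unif1]
  obtain v where v: "v \<in> V0" using \<open>V0 \<noteq> {}\<close> by auto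
  obtain u where u: "u \<in> V1" using m by fastforce
  have "hdegree ?E (Inr (v,u)) = card {e \<in> ?E. copy v {u} \<subseteq> e}"
    by (simp add: hdegree_def)
  also have "\<dots> = card {e\<in>E1. {u} \<subseteq> e} + ((card V1 - 1) choose (k - 2))"
    using card_subsets_containing_root_copy[OF E1(1), of "{u}" k v] u k
    by (subst card_corona_edges_copy[OF k E1(1,2) v]) (simp_all add: numeral_2_eq_2)
  also have "card {e\<in>E1. {u} \<subseteq> e} = r"
    using reg u by (simp add: regular_hg_def hdegree_def)
  finally have deg_copy: "d = r + ((card V1 - 1) choose (k - 2))"
    using d[of "Inr (v,u)"] u v by (simp add: corona_V_eq image_iff)
  \<comment> \<open>With \<open>copy v {}\<close> empty, \<open>?R\<close> is the set of all new
    hyperedges at \<open>v\<close>. Hyperedges of the base through \<open>v\<close> only increase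
    the degree, so a lower bound suffices.\<close>
  let ?R = "{S. S \<subseteq> insert (Inl v) (copy v V1) \<and> card S = k \<and> insert (Inl v) (copy v {}) \<subseteq> S}"
  have "card V1 choose (k - 1) = card ?R"
    using k by (subst card_subsets_containing_root_copy[OF E1(1)]) auto
  also have "\<dots> \<le> hdegree ?E (Inl v)"
    unfolding hdegree_def
  proof (rule card_mono)
    show "finite {e \<in> ?E. Inl v \<in> e}"
      using finite_corona_E[OF E0(1,2) E1(1,2) k] by simp
    show "?R \<subseteq> {e \<in> ?E. Inl v \<in> e}"
      unfolding corona_E_eq[OF k] using v by auto
  qed
  also have "\<dots> = d" using d[of "Inl v"] v by (simp add: corona_V_eq)
  finally have "card V1 choose (k - 1) \<le> r + ((card V1 - 1) choose (k - 2))"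
    using deg_copy by simp
  \<comment> \<open>Pascal's rule turns the comparison of degrees into \<open>r\<close> being at
    least \<open>(card V1 - 1) choose (k - 1)\<close>.\<close>
  moreover have "card V1 choose (k - 1)
      = ((card V1 - 1) choose (k - 2)) + ((card V1 - 1) choose (k - 1))"
    using choose_reduce_nat[of "card V1" "k - 1"] m k by (simp add: numeral_2_eq_2)
  ultimately show False using r by simp
qed

section \<open>The Seidel matrix of the corona\<close>

text \<open>With d the copy shift, an off-diagonal entry within a copy is -(1 - 2 (adj + d)) = (2 d
  - 1) - 2 (-adj). On the diagonal the same pattern reads (2 d - 1) - 2 t, which dictates the value
  of \<open>x\<close>.\<close>

lemma seidel_corona_kernel:
  fixes V0 :: "'a set" and V1 :: "'b set" and t :: real
  assumes k: "k \<ge> 2" and fin: "finite V1" "finite E1"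
    and x: "x = -2 * t - 1 + 2 * real (copy_shift k (card V1))"
    and y: "y \<in> corona_V V0 V1" "y' \<in> corona_V V0 V1"
  shows "(if y = y' then x else 0) - seidel_fun (corona_E k V0 E0 V1 E1) y y'
    = corona_kernel
        (\<lambda>v v'. (if v = v' then x else 0) - seidel_fun E0 v v')
        (\<lambda>v v'. 2 * (if v = v' then real ((card V1 - 1) choose (k - 2)) else 0) - 1)
        (\<lambda>v v'. if v = v' then 2 * real (copy_shift k (card V1)) - 1 else -1) (-2)
        (\<lambda>u u'. (if u = u' then t else 0) - adj_fun E1 u u') y y'"
proof (cases y)
  case (Inl v)
  show ?thesis
  proof (cases y')
    case Inl': (Inl v')
    show ?thesis
      by (simp add: Inl Inl' seidel_fun_def corona_kernel_def adj_fun_corona_Inl_Inl[OF k])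
  next
    case (Inr p)
    with y show ?thesis
      by (auto simp: Inl seidel_fun_def corona_kernel_def corona_V_eq adj_fun_corona_Inl_Inr[OF k fin(1)])
  qed
next
  case (Inr p)
  then obtain v u where p: "y = Inr (v,u)" and v: "v \<in> V0" "u \<in> V1"
    using y by (auto simp: corona_V_eq)
  show ?thesis
  proof (cases y')
    case Inl': (Inl v')
    show ?thesis
      using adj_fun_corona_Inl_Inr[OF k fin(1) v, of E0 E1 v']
        adj_fun_sym[of "corona_E k V0 E0 V1 E1" y y']
      by (auto simp: p Inl' seidel_fun_def corona_kernel_def)
  next
    case Inr': (Inr p')
    then obtain v' u' where p': "y' = Inr (v',u')" and v': "v' \<in> V0" "u' \<in> V1"
      using y by (auto simp: corona_V_eq)
    show ?thesis
    proof (cases "y = y'")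
      case True
      then show ?thesis
        by (simp add: p p' seidel_fun_def corona_kernel_def adj_fun_def x)
    next
      case False
      then show ?thesis
        using adj_fun_corona_Inr_Inr[OF k fin v(1) v'(1) v(2) v'(2), of E0]
        by (auto simp: p p' seidel_fun_def corona_kernel_def adj_fun_def[of E1 u u])
    qed
  qed
qed

text \<open>Multiplying the composed difference by \<open>c\<close> covers the excluded points, so
  the product vanishes everywhere. Composition with a nonconstant affine map kills no nonzero
  polynomial.\<close>

lemma poly_eq_if_eq_at_affine_image:
  fixes p q c :: "real poly"
  assumes "c \<noteq> 0" "a \<noteq> 0"
    and eq: "\<And>t. poly c t \<noteq> 0 \<Longrightarrow> poly p (a * t + b) = poly q (a * t + b)"
  shows "p = q"
proof -
  let ?d = "pcompose (p - q) [:b, a:]"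
  have "poly (?d * c) t = 0" for t
  proof (cases "poly c t = 0")
    case False
    have "b + t * a = a * t + b" by simp
    with eq[OF False] show ?thesis
      by (simp only: poly_mult poly_pcompose poly_diff poly_pCons poly_0 add_0_right
          mult_zero_right diff_self mult_zero_left)
  qed simp
  then have "?d * c = 0" by (intro poly_all_0_iff_0[THEN iffD1]) blast
  then have "?d = 0" using \<open>c \<noteq> 0\<close> by simp
  then have "p - q = 0" by (rule pcompose_eq_0) (simp add: \<open>a \<noteq> 0\<close>)
  then show ?thesis by simp
qed

lemma char_poly_seidel_corona:
  fixes V0 :: "'a set" and V1 :: "'b set" and W1 :: "'c set"
  assumes unif: "uniform_hg k V0 E0" and reg: "regular_hg k r V1 E1" "regular_hg k r W1 F1"
    and card: "card V1 = card W1" and k: "k \<ge> 2"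
    and cp: "char_poly (adj_matrix V1 E1) = char_poly (adj_matrix W1 F1)"
  shows "char_poly (seidel_matrix (corona_V V0 V1) (corona_E k V0 E0 V1 E1))
       = char_poly (seidel_matrix (corona_V V0 W1) (corona_E k V0 E0 W1 F1))"
proof -
  have unif1: "uniform_hg k V1 E1" "uniform_hg k W1 F1" using reg by (simp_all add: regular_hg_def)
  note V0 = uniform_hg_edges[OF unif] and V1 = uniform_hg_edges[OF unif1(1)]
    and W1 = uniform_hg_edges[OF unif1(2)]
  \<comment> \<open>Any bijection serves: it only places both adjacency matrices on the index set
    \<open>V1\<close>.\<close>
  obtain f where f: "bij_betw f V1 W1"
    using card V1(1) W1(1) finite_same_card_bij by blast
  have inj: "inj_on f V1" and W: "W1 = f ` V1" using f by (auto simp: bij_betw_def)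
  let ?phi = "map_sum id (map_prod id f) :: 'a + 'a \<times> 'b \<Rightarrow> 'a + 'a \<times> 'c"
  have phi_img: "corona_V V0 W1 = ?phi ` corona_V V0 V1"
    by (simp add: corona_V_eq W image_Un image_image map_prod_surj_on[of id V0 V0 f V1 "f ` V1"]
        flip: image_image[of Inr "map_prod id f"])
  have phi_inj: "inj_on ?phi (corona_V V0 V1)"
  proof (rule inj_onI)
    fix p q assume "p \<in> corona_V V0 V1" "q \<in> corona_V V0 V1" "?phi p = ?phi q"
    then show "p = q"
      by (cases p; cases q) (auto simp: corona_V_eq dest: inj_onD[OF inj])
  qed
  note finC = finite_corona_V[OF V0(1) V1(1)] finite_corona_V[OF V0(1) W1(1)]
  let ?S = "copy_shift k (card V1)"
  let ?c = "char_poly (adj_matrix V1 E1)"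
  \<comment> \<open>Excluding the eigenvalues of the adjacency matrix of \<open>V1\<close> keeps
    \<open>z\<close> invertible. The affine map is t \<mapsto> \<open>x\<close>.\<close>
  show ?thesis
  proof (rule poly_eq_if_eq_at_affine_image[of ?c "-2" _ "2 * real ?S - 1"])
    show "?c \<noteq> 0"
      using degree_monic_char_poly[OF adj_matrix_carrier[of V1 E1]] by auto
  next
    fix t assume t: "poly ?c t \<noteq> 0"
    define x where "x = -2 * t - 1 + 2 * real ?S"
    define z where "z u v = (if u = v then t else 0) - adj_fun E1 u v" for u v
    define y where "y u v = (if u = v then t else 0) - adj_fun F1 u v" for u v
    define z' where "z' u v = y (f u) (f v)" for u v
    define g where "g v v' = (if v = v' then x else 0) - seidel_fun E0 v v'" for v v'
    define h where
      "h v v' = 2 * (if v = v' then real ((card V1 - 1) choose (k - 2)) else 0) - 1" for v v' :: 'a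
    define b where "b v v' = (if v = v' then 2 * real ?S - 1 else -1)" for v v' :: 'a
    have det_z: "set_det V1 z = poly ?c t"
      unfolding z_def by (rule poly_char_poly_adj[OF V1(1), symmetric])
    also have "\<dots> = set_det W1 y"
      unfolding y_def cp by (rule poly_char_poly_adj[OF W1(1)])
    also have "\<dots> = set_det V1 z'"
      unfolding W z'_def by (rule set_det_image[OF V1(1) inj])
    finally have det_eq: "set_det V1 z = set_det V1 z'" .
    have nz: "set_det V1 z \<noteq> 0"
      using t det_z by simp
    have col: "(\<Sum>u\<in>V1. z u v) = t - real (r * (k - 1))" if "v \<in> V1" for v
      using that V1(1) by (simp add: z_def sum_subtractf sum_adj_fun_regular[OF reg(1)])
    have col': "(\<Sum>u\<in>V1. z' u v) = t - real (r * (k - 1))" if "v \<in> V1" for v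
    proof -
      have "(\<Sum>u\<in>V1. z' u v) = (\<Sum>w\<in>W1. y w (f v))"
        unfolding z'_def by (rule sum.reindex_bij_betw[OF f])
      also have "\<dots> = t - real (r * (k - 1))"
        using bij_betw_apply[OF f that] W1(1)
        by (simp add: y_def sum_subtractf sum_adj_fun_regular[OF reg(2)])
      finally show ?thesis .
    qed
    have "poly (char_poly (seidel_matrix (corona_V V0 V1) (corona_E k V0 E0 V1 E1))) x
        = set_det (corona_V V0 V1) (corona_kernel g h b (-2) z)"
      unfolding poly_char_poly_seidel[OF finC(1)] z_def g_def h_def b_def
      by (rule set_det_cong[OF finC(1)]) (rule seidel_corona_kernel[OF k V1(1,2) x_def])
    also have "\<dots> = set_det (corona_V V0 V1) (corona_kernel g h b (-2) z')"
      using V0(1) V1(1) det_eq nz col col' by (rule set_det_corona_kernel_exchange)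
    \<comment> \<open>Since \<open>z'\<close> is \<open>y\<close> pulled back along
      \<open>f\<close>, the kernel is pulled back along \<open>?phi\<close>, and reindexing moves it
      to the second corona.\<close>
    also have "\<dots> = set_det (corona_V V0 V1) (\<lambda>p q. corona_kernel g h b (-2) y (?phi p) (?phi q))"
      by (rule set_det_cong[OF finC(1)])
         (auto simp: corona_kernel_def z'_def split: sum.split prod.split)
    also have "\<dots> = set_det (corona_V V0 W1) (corona_kernel g h b (-2) y)"
      unfolding phi_img by (rule set_det_image[OF finC(1) phi_inj, symmetric])
    also have "\<dots> = poly (char_poly (seidel_matrix (corona_V V0 W1) (corona_E k V0 E0 W1 F1))) x"
      unfolding poly_char_poly_seidel[OF finC(2)] y_def g_def h_def b_def card
      by (rule set_det_cong[OF finC(2)])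
         (rule seidel_corona_kernel[OF k W1(1,2) x_def[unfolded card], symmetric])
    finally show "poly (char_poly (seidel_matrix (corona_V V0 V1) (corona_E k V0 E0 V1 E1)))
          (-2 * t + (2 * real ?S - 1))
        = poly (char_poly (seidel_matrix (corona_V V0 W1) (corona_E k V0 E0 W1 F1)))
          (-2 * t + (2 * real ?S - 1))"
      by (simp add: x_def algebra_simps)
  qed simp
qed

theorem theorem6p2:
  fixes V0 :: "'a set" and E0 :: "'a set set"
    and V1 :: "'b set" and E1 :: "'b set set"
    and W1 :: "'c set" and F1 :: "'c set set"
    and k r n m :: nat
  assumes "uniform_hg k V0 E0" and "card V0 = n" and "n \<ge> 1"
    and "regular_hg k r V1 E1" and "regular_hg k r W1 F1"
    and "card V1 = m" and "card W1 = m" and "m \<ge> 2"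
    and "\<not> hg_isomorphic V1 E1 W1 F1"
    and "spectrum_mset (adj_matrix V1 E1) = spectrum_mset (adj_matrix W1 F1)"
    and "2 \<le> k" and "k \<le> m + 1"
  shows "\<not> is_regular (corona_V V0 V1) (corona_E k V0 E0 V1 E1)
       \<and> \<not> is_regular (corona_V V0 W1) (corona_E k V0 E0 W1 F1)
       \<and> spectrum_mset (seidel_matrix (corona_V V0 V1) (corona_E k V0 E0 V1 E1))
         = spectrum_mset (seidel_matrix (corona_V V0 W1) (corona_E k V0 E0 W1 F1))"
proof (intro conjI)
  have ne: "V0 \<noteq> {}" using assms(2,3) by auto
  \<comment> \<open>Both hypergraphs have the same \<open>r\<close> and \<open>m\<close>, so one
    bound serves both coronas.\<close>
  have lt: "r < (m - 1) choose (k - 1)"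
    using regular_hg_not_complete[OF assms(4,5)] assms(6,7,9,11) by simp
  show "\<not> is_regular (corona_V V0 V1) (corona_E k V0 E0 V1 E1)"
    using corona_not_regular[OF assms(1,4,11) ne] assms(6,8) lt by simp
  show "\<not> is_regular (corona_V V0 W1) (corona_E k V0 E0 W1 F1)"
    using corona_not_regular[OF assms(1,5,11) ne] assms(7,8) lt by simp
  have "char_poly (adj_matrix V1 E1) = char_poly (adj_matrix W1 F1)"
    using assms(10) spectrum_mset_eq_iff[OF adj_matrix_carrier adj_matrix_carrier] by blast
  then have "char_poly (seidel_matrix (corona_V V0 V1) (corona_E k V0 E0 V1 E1))
      = char_poly (seidel_matrix (corona_V V0 W1) (corona_E k V0 E0 W1 F1))"
    using assms(6,7) by (intro char_poly_seidel_corona[OF assms(1,4,5) _ assms(11)]) simp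
  then show "spectrum_mset (seidel_matrix (corona_V V0 V1) (corona_E k V0 E0 V1 E1))
      = spectrum_mset (seidel_matrix (corona_V V0 W1) (corona_E k V0 E0 W1 F1))"
    using spectrum_mset_eq_iff[OF seidel_matrix_carrier seidel_matrix_carrier] by blast
qed

end
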